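(* Let $\mathfrak m_2$ be the infinite dimensional $\mathbb N$-graded Lie algebra over $\mathbb K$ ($\mathbb K=\mathbb R$ or $\mathbb C$) with basis $(e_i)_{i\ge 1}$ and only non-trivial brackets (up to antisymmetry) $[e_1,e_i]=e_{i+1}$ for $i\ge 2$ and $[e_2,e_j]=e_{j+2}$ for $j\ge 3$. Then $H^1(\mathfrak m_2,\mathfrak m_2)$ is a graded Lie algebra (graded by the weight), generated by the classes of the following $1$-cocycles: $\omega$ of degree $0$, $\alpha$ of degree $2$, and $\gamma_l$ of degree $l$ for each $l\ge 3$, where $$\omega(e_k)=k\,e_k\ (k\ge 1),\qquad \alpha(e_1)=0,\quad \alpha(e_k)=b\,e_{k+2}\ (k\ge 2),$$ $$\gamma_l(e_1)=-\tfrac{c_l}{2}e_{l+1},\quad \gamma_l(e_2)=\tfrac{c_l}{2}e_{l+2},\quad \gamma_l(e_k)=c_l\,e_{k+l}\ (k\ge 3),$$ with $b,c_l\in\mathbb K$ non-zero constants. In this Lie algebra, $\alpha$ and the $\gamma_l$, $l\ge 3$, generate a trivial (abelian) Lie algebra, on which $\omega$ acts as a grading operator: $[\omega,\alpha]=2\alpha$ and $[\omega,\gamma_l]=l\,\gamma_l$ for all $l\ge 3$.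
   Context: Cohomology is Lie algebra cohomology with coefficients in the adjoint representation. A $1$-cochain $a$ is homogeneous of weight (degree) $l\in\mathbb Z$ if $a(e_i)\in\mathbb K e_{i+l}$ for all $i$ (with $e_k:=0$ for $k\le 0$), and $H^1(\mathfrak m_2,\mathfrak m_2)$ is considered through its homogeneous components, i.e. as $\bigoplus_{l\in\mathbb Z}H^1_l(\mathfrak m_2,\mathfrak m_2)$, where $H^1_l$ is homogeneous $1$-cocycles of weight $l$ modulo homogeneous $1$-coboundaries of weight $l$. The Lie bracket on $H^1(\mathfrak m_2,\mathfrak m_2)$ is induced by the commutator of cochains $[a,b](x)=a(b(x))-b(a(x))$. *)

theory Defs
  imports Complex_Main "HOL-Library.Poly_Mapping" "HOL-Library.Function_Algebras"
begin

section \<open>Lie algebras\<close>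

locale lie_algebra = vector_space scale
  for scale :: "'k::field \<Rightarrow> 'v::ab_group_add \<Rightarrow> 'v" +
  fixes bracket :: "'v \<Rightarrow> 'v \<Rightarrow> 'v"
  assumes bracket_linear_left: "Vector_Spaces.linear scale scale (\<lambda>x. bracket x y)"
    and bracket_linear_right: "Vector_Spaces.linear scale scale (\<lambda>y. bracket x y)"
    and bracket_self: "bracket x x = 0"
    and jacobi: "bracket x (bracket y z) + bracket y (bracket z x) + bracket z (bracket x y) = 0"
begin

definition lie_subalgebra :: "'v set \<Rightarrow> bool" where
  "lie_subalgebra S \<longleftrightarrow> subspace S \<and> (\<forall>x\<in>S. \<forall>y\<in>S. bracket x y \<in> S)"

definition lie_generated :: "'v set \<Rightarrow> 'v set" where
  "lie_generated S = lie_subalgebra hull S"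

text \<open>\<open>d0\<close> and \<open>d1\<close> are the Chevalley--Eilenberg differentials in degrees 0 and 1 with
  coefficients in the adjoint representation.\<close>

definition d0 :: "'v \<Rightarrow> 'v \<Rightarrow> 'v" where
  "d0 v = (\<lambda>x. bracket x v)"

definition d1 :: "('v \<Rightarrow> 'v) \<Rightarrow> 'v \<Rightarrow> 'v \<Rightarrow> 'v" where
  "d1 a = (\<lambda>x y. bracket x (a y) - bracket y (a x) - a (bracket x y))"

definition cochains1 :: "('v \<Rightarrow> 'v) set" where
  "cochains1 = {a. Vector_Spaces.linear scale scale a}"

definition cocycles1 :: "('v \<Rightarrow> 'v) set" where
  "cocycles1 = {a \<in> cochains1. \<forall>x y. d1 a x y = 0}"

definition coboundaries1 :: "('v \<Rightarrow> 'v) set" where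
  "coboundaries1 = range d0"

definition homogeneous_cochains1 :: "(int \<Rightarrow> 'v) \<Rightarrow> int \<Rightarrow> ('v \<Rightarrow> 'v) set" where
  "homogeneous_cochains1 e l = {a \<in> cochains1. \<forall>i. \<exists>c. a (e i) = scale c (e (i + l))}"

lemmas br_add_left = Vector_Spaces.linear.axioms(3)[OF bracket_linear_left, THEN module_hom.add]
lemmas br_add_right = Vector_Spaces.linear.axioms(3)[OF bracket_linear_right, THEN module_hom.add]
lemmas br_diff_left = Vector_Spaces.linear.axioms(3)[OF bracket_linear_left, THEN module_hom.diff]
lemmas br_diff_right = Vector_Spaces.linear.axioms(3)[OF bracket_linear_right, THEN module_hom.diff]
lemmas br_scale_left = Vector_Spaces.linear.axioms(3)[OF bracket_linear_left, THEN module_hom.scale]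
lemmas br_scale_right = Vector_Spaces.linear.axioms(3)[OF bracket_linear_right, THEN module_hom.scale]
lemmas br_zero_right = Vector_Spaces.linear.axioms(3)[OF bracket_linear_right, THEN module_hom.zero]
lemmas br_neg_right = Vector_Spaces.linear.axioms(3)[OF bracket_linear_right, THEN module_hom.neg]

lemma br_antisym: "bracket y x = - bracket x y"
proof -
  have "bracket (x + y) (x + y) = 0" by (rule bracket_self)
  then have "bracket x y + bracket y x = 0"
    by (simp only: br_add_left br_add_right) (simp add: bracket_self add.commute)
  then show ?thesis by (simp add: add.commute eq_neg_iff_add_eq_0)
qed

lemma cocycle1_iff_derivation:
  "a \<in> cocycles1 \<longleftrightarrow> Vector_Spaces.linear scale scale a \<and>
     (\<forall>x y. a (bracket x y) = bracket (a x) y + bracket x (a y))"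
proof -
  have "d1 a x y = 0 \<longleftrightarrow> a (bracket x y) = bracket (a x) y + bracket x (a y)" for x y
    using br_antisym[of y "a x"] by (auto simp: d1_def algebra_simps)
  then show ?thesis by (auto simp: cocycles1_def cochains1_def)
qed

lemma coboundaries1_subset_cocycles1: "coboundaries1 \<subseteq> cocycles1"
proof
  fix a assume "a \<in> coboundaries1"
  then obtain v where a: "a = (\<lambda>x. bracket x v)" by (auto simp: coboundaries1_def d0_def)
  have "bracket (bracket x y) v = bracket (bracket x v) y + bracket x (bracket y v)" for x y
  proof -
    have "bracket (bracket x y) v = - bracket v (bracket x y)" by (rule br_antisym)
    also have "\<dots> = bracket x (bracket y v) + bracket y (bracket v x)"
      using jacobi[of x y v] by (metis add.inverse_unique add.commute)
    also have "bracket y (bracket v x) = bracket (bracket x v) y"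
      using br_antisym[of "bracket x v" y] br_antisym[of v x] by (simp add: br_neg_right)
    finally show ?thesis by (simp add: add.commute)
  qed
  then show "a \<in> cocycles1"
    using bracket_linear_left by (auto simp: cocycle1_iff_derivation a)
qed

end

locale graded_lie_algebra = lie_algebra scale bracket
  for scale :: "'k::field \<Rightarrow> 'v::ab_group_add \<Rightarrow> 'v" and bracket +
  fixes G :: "int \<Rightarrow> 'v set"
  assumes subspace_component: "subspace (G l)"
    and unique_decomposition:
      "\<exists>!f. (\<forall>l. f l \<in> G l) \<and> finite {l. f l \<noteq> 0} \<and> x = (\<Sum>l | f l \<noteq> 0. f l)"
    and bracket_component: "x \<in> G l \<Longrightarrow> y \<in> G m \<Longrightarrow> bracket x y \<in> G (l + m)"

section \<open>The Lie algebra \<open>m\<^sub>2\<close>\<close>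

text \<open>The coefficient of \<open>e\<^sub>k\<close>, \<open>k \<ge> 1\<close>, is stored at position \<open>k - 1\<close>.\<close>

type_synonym 'k m2 = "nat \<Rightarrow>\<^sub>0 'k"

abbreviation "lookup \<equiv> Poly_Mapping.lookup"
abbreviation "keys \<equiv> Poly_Mapping.keys"

definition m2_e :: "int \<Rightarrow> 'k::field_char_0 m2" where
  "m2_e k = (if k \<ge> 1 then Poly_Mapping.single (nat (k - 1)) 1 else 0)"

definition m2_scale :: "'k::field_char_0 \<Rightarrow> 'k m2 \<Rightarrow> 'k m2" where
  "m2_scale c = Poly_Mapping.map ((*) c)"

text \<open>\<open>m2_basis_bracket i j\<close> is \<open>[e\<^sub>i, e\<^sub>j]\<close> for \<open>i, j \<ge> 1\<close>.\<close>

definition m2_basis_bracket :: "int \<Rightarrow> int \<Rightarrow> 'k::field_char_0 m2" where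
  "m2_basis_bracket i j =
    (if i = 1 \<and> j \<ge> 2 then m2_e (j + 1)
     else if i \<ge> 2 \<and> j = 1 then - m2_e (i + 1)
     else if i = 2 \<and> j \<ge> 3 then m2_e (j + 2)
     else if i \<ge> 3 \<and> j = 2 then - m2_e (i + 2)
     else 0)"

definition m2_bracket :: "'k::field_char_0 m2 \<Rightarrow> 'k m2 \<Rightarrow> 'k m2" where
  "m2_bracket x y = (\<Sum>i\<in>keys x. \<Sum>j\<in>keys y.
     m2_scale (lookup x i * lookup y j) (m2_basis_bracket (int i + 1) (int j + 1)))"

lemma lookup_m2_scale [simp]: "lookup (m2_scale c x) i = c * lookup x i"
  by (simp add: m2_scale_def Poly_Mapping.map.rep_eq when_def)

lemma vector_space_m2: "vector_space m2_scale"
  by unfold_locales (auto intro!: poly_mapping_eqI simp: lookup_add algebra_simps)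

global_interpretation m2V: vector_space m2_scale
  by (rule vector_space_m2)

lemma lookup_m2_e: "k \<ge> 1 \<Longrightarrow> lookup (m2_e k) i = (if int i + 1 = k then 1 else 0)"
  by (auto simp: m2_e_def lookup_single when_def)

lemma m2_expand:
  assumes "finite A" "keys x \<subseteq> A"
  shows "x = (\<Sum>i\<in>A. m2_scale (lookup x i) (m2_e (int i + 1)))"
proof (rule poly_mapping_eqI)
  fix k
  have "(\<Sum>i\<in>A. lookup (m2_scale (lookup x i) (m2_e (int i + 1))) k)
      = (\<Sum>i\<in>A. if i = k then lookup x k else 0)"
    by (rule sum.cong) (auto simp: m2_e_def lookup_single when_def)
  also have "\<dots> = lookup x k"
    using assms by (auto simp: in_keys_iff)
  finally show "lookup x k = lookup (\<Sum>i\<in>A. m2_scale (lookup x i) (m2_e (int i + 1))) k"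
    by (simp add: lookup_sum)
qed

lemma span_m2_e: "m2V.span (m2_e ` {1..}) = UNIV"
proof -
  have "x \<in> m2V.span (m2_e ` {1..})" for x :: "'a m2"
    by (subst m2_expand[OF finite_keys subset_refl])
       (rule m2V.span_sum, rule m2V.span_scale, rule m2V.span_base, simp)
  then show ?thesis by auto
qed

lemma inj_on_m2_e: "inj_on (m2_e :: int \<Rightarrow> 'k::field_char_0 m2) {1..}"
proof (rule inj_onI)
  fix i j :: int assume *: "i \<in> {1..}" "j \<in> {1..}" "m2_e i = (m2_e j :: 'k m2)"
  then have "lookup (m2_e i :: 'k m2) (nat (i - 1)) = lookup (m2_e j :: 'k m2) (nat (i - 1))"
    by simp
  then have "1 = (if i = j then 1 else (0 :: 'k))" using *(1,2) by (simp add: lookup_m2_e)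
  then show "i = j" by (simp split: if_splits)
qed

lemma independent_m2_e: "m2V.independent (m2_e ` {1..} :: 'k::field_char_0 m2 set)"
proof (subst m2V.independent_explicit_finite_subsets, intro allI impI)
  fix A :: "'k m2 set" and u v
  assume A: "A \<subseteq> m2_e ` {1..}" "finite A" "(\<Sum>v\<in>A. m2_scale (u v) v) = 0"
  have "u v = 0" if v: "v \<in> A" for v
  proof -
    from A v obtain k where k: "k \<ge> 1" "v = m2_e k" by auto
    have "0 = lookup (\<Sum>v\<in>A. m2_scale (u v) v) (nat (k - 1))" using A by simp
    also have "\<dots> = (\<Sum>w\<in>A. u w * lookup w (nat (k - 1)))" by (simp add: lookup_sum)
    also have "\<dots> = (\<Sum>w\<in>A. if w = v then u v else 0)"
    proof (rule sum.cong[OF refl])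
      fix w assume "w \<in> A"
      then obtain j where j: "j \<ge> 1" "w = m2_e j" using A by auto
      show "u w * lookup w (nat (k - 1)) = (if w = v then u v else 0)"
        using j k inj_onD[OF inj_on_m2_e, of j k] by (auto simp: lookup_m2_e)
    qed
    also have "\<dots> = u v" using v A by simp
    finally show ?thesis by simp
  qed
  then show "\<forall>v\<in>A. u v = 0" by blast
qed

lemma m2_bracket_superset:
  assumes "finite A" "keys x \<subseteq> A" "finite B" "keys y \<subseteq> B"
  shows "m2_bracket x y = (\<Sum>i\<in>A. \<Sum>j\<in>B.
     m2_scale (lookup x i * lookup y j) (m2_basis_bracket (int i + 1) (int j + 1)))"
proof -
  have "(\<Sum>j\<in>keys y. m2_scale (lookup x i * lookup y j) (m2_basis_bracket (int i + 1) (int j + 1)))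
      = (\<Sum>j\<in>B. m2_scale (lookup x i * lookup y j) (m2_basis_bracket (int i + 1) (int j + 1)))" for i
    by (rule sum.mono_neutral_left) (use assms in \<open>auto simp: in_keys_iff\<close>)
  then show ?thesis
    unfolding m2_bracket_def
    by (simp, intro sum.mono_neutral_left) (use assms in \<open>auto simp: in_keys_iff\<close>)
qed

lemma m2_bracket_add_left: "m2_bracket (x + x') y = m2_bracket x y + m2_bracket x' y"
proof -
  let ?A = "keys x \<union> keys x' \<union> keys (x + x')"
  show ?thesis
    by (subst (1 2 3) m2_bracket_superset[of ?A _ "keys y"])
       (auto simp: lookup_add algebra_simps m2V.scale_left_distrib sum.distrib)
qed

lemma m2_bracket_scale_left: "m2_bracket (m2_scale c x) y = m2_scale c (m2_bracket x y)"
proof -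
  let ?A = "keys x \<union> keys (m2_scale c x)"
  show ?thesis
    by (subst (1 2) m2_bracket_superset[of ?A _ "keys y"])
       (auto simp: algebra_simps m2V.scale_sum_right)
qed

lemma m2_basis_bracket_antisym: "m2_basis_bracket j i = - m2_basis_bracket i j"
  by (auto simp: m2_basis_bracket_def)

lemma m2_bracket_antisym: "m2_bracket y x = - m2_bracket x y"
proof -
  have "m2_scale (lookup y j * lookup x i) (m2_basis_bracket (int j + 1) (int i + 1))
      = - m2_scale (lookup x i * lookup y j) (m2_basis_bracket (int i + 1) (int j + 1))" for i j
    unfolding m2_basis_bracket_antisym[of "int j + 1" "int i + 1"]
    by (simp only: m2V.scale_minus_right mult.commute[of "lookup y j"])
  then show ?thesis
    unfolding m2_bracket_def by (subst sum.swap) (simp only: sum_negf)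
qed

lemma m2_bracket_linear_left: "Vector_Spaces.linear m2_scale m2_scale (\<lambda>x. m2_bracket x y)"
  by unfold_locales (simp_all add: m2_bracket_add_left m2_bracket_scale_left)

lemma m2_bracket_linear_right: "Vector_Spaces.linear m2_scale m2_scale (\<lambda>y. m2_bracket x y)"
  by unfold_locales
     (simp_all add: m2_bracket_antisym[of x] m2_bracket_add_left m2_bracket_scale_left
       m2V.scale_minus_right)

lemma m2_bracket_self: "m2_bracket x x = 0"
proof (rule poly_mapping_eqI)
  fix k
  have "lookup (m2_bracket x x) k = - lookup (m2_bracket x x) k"
    using m2_bracket_antisym[of x x] by (metis lookup_uminus uminus_apply)
  then show "lookup (m2_bracket x x) k = lookup 0 k" by simp
qed

lemma m2_bracket_basis: "i \<ge> 1 \<Longrightarrow> j \<ge> 1 \<Longrightarrow> m2_bracket (m2_e i) (m2_e j) = m2_basis_bracket i j"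
  by (subst m2_bracket_superset[of "{nat (i - 1)}" _ "{nat (j - 1)}"])
     (auto simp: m2_e_def split: if_splits)

lemma m2_linear_eq_0:
  assumes "Vector_Spaces.linear m2_scale m2_scale f" "\<And>k. k \<ge> 1 \<Longrightarrow> f (m2_e k) = 0"
  shows "f x = 0"
proof -
  interpret Vector_Spaces.linear m2_scale m2_scale f by fact
  have "f x = f (\<Sum>i\<in>keys x. m2_scale (lookup x i) (m2_e (int i + 1)))"
    using m2_expand[of "keys x" x] by simp
  also have "\<dots> = 0" by (simp add: sum scale assms(2))
  finally show ?thesis .
qed

lemmas m2_bracket_simps =
  Vector_Spaces.linear.axioms(3)[OF m2_bracket_linear_left, THEN module_hom.neg]
  Vector_Spaces.linear.axioms(3)[OF m2_bracket_linear_right, THEN module_hom.neg]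
  Vector_Spaces.linear.axioms(3)[OF m2_bracket_linear_left, THEN module_hom.zero]
  Vector_Spaces.linear.axioms(3)[OF m2_bracket_linear_right, THEN module_hom.zero]
  Vector_Spaces.linear.axioms(3)[OF m2_bracket_linear_left, THEN module_hom.add]
  Vector_Spaces.linear.axioms(3)[OF m2_bracket_linear_right, THEN module_hom.add]
  Vector_Spaces.linear.axioms(3)[OF m2_bracket_linear_left, THEN module_hom.scale]
  Vector_Spaces.linear.axioms(3)[OF m2_bracket_linear_right, THEN module_hom.scale]

lemma m2_jacobi_basis:
  assumes "i \<ge> 1" "j \<ge> 1" "k \<ge> 1"
  shows "m2_bracket (m2_e i) (m2_bracket (m2_e j) (m2_e k))
    + m2_bracket (m2_e j) (m2_bracket (m2_e k) (m2_e i))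
    + m2_bracket (m2_e k) (m2_bracket (m2_e i) (m2_e j)) = 0"
proof -
  have c: "n = 1 \<or> n = 2 \<or> n \<ge> 3" if "n \<ge> 1" for n :: int using that by auto
  show ?thesis
    using c[OF assms(1)] c[OF assms(2)] c[OF assms(3)]
    by (elim disjE; simp add: m2_bracket_basis m2_basis_bracket_def m2_bracket_simps)
qed

lemma m2_jacobi:
  "m2_bracket x (m2_bracket y z) + m2_bracket y (m2_bracket z x) + m2_bracket z (m2_bracket x y) = 0"
proof -
  define J where "J x y z = m2_bracket x (m2_bracket y z) + m2_bracket y (m2_bracket z x)
    + m2_bracket z (m2_bracket x y)" for x y z :: "'a m2"
  have l1: "Vector_Spaces.linear m2_scale m2_scale (\<lambda>x. J x y z)" for y z
    by unfold_locales (simp_all add: J_def m2_bracket_simps algebra_simps)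
  have l2: "Vector_Spaces.linear m2_scale m2_scale (\<lambda>y. J x y z)" for x z
    by unfold_locales (simp_all add: J_def m2_bracket_simps algebra_simps)
  have l3: "Vector_Spaces.linear m2_scale m2_scale (\<lambda>z. J x y z)" for x y
    by unfold_locales (simp_all add: J_def m2_bracket_simps algebra_simps)
  have "J (m2_e i) (m2_e j) (m2_e k) = 0" if "i \<ge> 1" "j \<ge> 1" "k \<ge> 1" for i j k
    using that m2_jacobi_basis by (simp add: J_def)
  then have "J (m2_e i) (m2_e j) z = 0" if "i \<ge> 1" "j \<ge> 1" for i j z
    using that m2_linear_eq_0[OF l3] by blast
  then have "J (m2_e i) y z = 0" if "i \<ge> 1" for i y z
    using that m2_linear_eq_0[OF l2] by blast
  then have "J x y z = 0" using m2_linear_eq_0[OF l1] by blast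
  then show ?thesis by (simp add: J_def)
qed

global_interpretation m2: lie_algebra m2_scale m2_bracket
  by unfold_locales
     (simp_all add: m2_bracket_simps m2_bracket_self m2_jacobi)

section \<open>The first adjoint cohomology of \<open>m\<^sub>2\<close>\<close>

definition cochain_scale :: "'k::field_char_0 \<Rightarrow> ('k m2 \<Rightarrow> 'k m2) \<Rightarrow> 'k m2 \<Rightarrow> 'k m2" where
  "cochain_scale c a = (\<lambda>x. m2_scale c (a x))"

global_interpretation cochain: vector_space cochain_scale
  by unfold_locales (auto simp: cochain_scale_def fun_eq_iff m2V.scale_right_distrib
    m2V.scale_left_distrib)

definition cochain_bracket ::
    "('k::field_char_0 m2 \<Rightarrow> 'k m2) \<Rightarrow> ('k m2 \<Rightarrow> 'k m2) \<Rightarrow> 'k m2 \<Rightarrow> 'k m2" where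
  "cochain_bracket a b = (\<lambda>x. a (b x) - b (a x))"

definition Z1_comp :: "int \<Rightarrow> ('k::field_char_0 m2 \<Rightarrow> 'k m2) set" where
  "Z1_comp l = m2.cocycles1 \<inter> m2.homogeneous_cochains1 m2_e l"

definition B1_comp :: "int \<Rightarrow> ('k::field_char_0 m2 \<Rightarrow> 'k m2) set" where
  "B1_comp l = m2.coboundaries1 \<inter> m2.homogeneous_cochains1 m2_e l"

text \<open>The direct sums of the homogeneous components, formed inside the space of all cochains.\<close>

definition Z1 :: "('k::field_char_0 m2 \<Rightarrow> 'k m2) set" where
  "Z1 = cochain.span (\<Union>l. Z1_comp l)"

definition B1 :: "('k::field_char_0 m2 \<Rightarrow> 'k m2) set" where
  "B1 = cochain.span (\<Union>l. B1_comp l)"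

lemma cochain_bracket_Z1_comp:
  assumes a: "a \<in> Z1_comp l" and b: "b \<in> Z1_comp m"
  shows "cochain_bracket a b \<in> Z1_comp (l + m)"
proof -
  have la: "Vector_Spaces.linear m2_scale m2_scale a"
    and da: "a (m2_bracket x y) = m2_bracket (a x) y + m2_bracket x (a y)"
    and ha: "\<exists>c. a (m2_e i) = m2_scale c (m2_e (i + l))" for x y i
    using a by (auto simp: Z1_comp_def m2.cocycle1_iff_derivation m2.homogeneous_cochains1_def)
  have lb: "Vector_Spaces.linear m2_scale m2_scale b"
    and db: "b (m2_bracket x y) = m2_bracket (b x) y + m2_bracket x (b y)"
    and hb: "\<exists>c. b (m2_e i) = m2_scale c (m2_e (i + m))" for x y i
    using b by (auto simp: Z1_comp_def m2.cocycle1_iff_derivation m2.homogeneous_cochains1_def)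
  interpret a: Vector_Spaces.linear m2_scale m2_scale a by fact
  interpret b: Vector_Spaces.linear m2_scale m2_scale b by fact
  have lin: "Vector_Spaces.linear m2_scale m2_scale (cochain_bracket a b)"
    by unfold_locales
       (simp_all add: cochain_bracket_def a.add b.add a.scale b.scale m2V.scale_right_diff_distrib)
  have "\<exists>c. cochain_bracket a b (m2_e i) = m2_scale c (m2_e (i + (l + m)))" for i
  proof -
    obtain c1 c2 c3 c4 where c: "a (m2_e i) = m2_scale c1 (m2_e (i + l))"
      "b (m2_e i) = m2_scale c2 (m2_e (i + m))"
      "a (m2_e (i + m)) = m2_scale c3 (m2_e (i + m + l))"
      "b (m2_e (i + l)) = m2_scale c4 (m2_e (i + l + m))"
      using ha hb by meson
    have *: "i + m + l = i + (l + m)" "i + l + m = i + (l + m)" by simp_all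
    have "cochain_bracket a b (m2_e i) = m2_scale (c2 * c3 - c1 * c4) (m2_e (i + (l + m)))"
      unfolding cochain_bracket_def c a.scale b.scale *
      by (simp add: m2V.scale_left_diff_distrib)
    then show ?thesis ..
  qed
  moreover have "cochain_bracket a b (m2_bracket x y)
      = m2_bracket (cochain_bracket a b x) y + m2_bracket x (cochain_bracket a b y)" for x y
    by (simp add: cochain_bracket_def da db a.add b.add m2.br_diff_left m2.br_diff_right)
  ultimately show ?thesis
    using lin
    by (auto simp: Z1_comp_def m2.cocycle1_iff_derivation m2.homogeneous_cochains1_def
        m2.cochains1_def)
qed

lemma B1_comp_subset_Z1_comp: "B1_comp l \<subseteq> Z1_comp l"
  using m2.coboundaries1_subset_cocycles1 by (auto simp: B1_comp_def Z1_comp_def)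

lemma cochain_bracket_B1_comp:
  assumes a: "a \<in> Z1_comp l" and b: "b \<in> B1_comp m"
  shows "cochain_bracket a b \<in> B1_comp (l + m)"
proof -
  from b obtain v where v: "b = (\<lambda>x. m2_bracket x v)"
    by (auto simp: B1_comp_def m2.coboundaries1_def m2.d0_def)
  have "cochain_bracket a b = m2.d0 (a v)"
    using a by (auto simp: cochain_bracket_def v m2.d0_def fun_eq_iff Z1_comp_def
        m2.cocycle1_iff_derivation)
  then have "cochain_bracket a b \<in> m2.coboundaries1" by (auto simp: m2.coboundaries1_def)
  moreover have "cochain_bracket a b \<in> Z1_comp (l + m)"
    using cochain_bracket_Z1_comp a b B1_comp_subset_Z1_comp by blast
  ultimately show ?thesis by (auto simp: B1_comp_def Z1_comp_def)
qed

lemma Z1_linear: "a \<in> Z1 \<Longrightarrow> Vector_Spaces.linear m2_scale m2_scale a"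
  unfolding Z1_def
proof (induction rule: cochain.span_induct_alt)
  case base
  show ?case by unfold_locales simp_all
next
  case (step c x y)
  then interpret y: Vector_Spaces.linear m2_scale m2_scale y by simp
  from step interpret x: Vector_Spaces.linear m2_scale m2_scale x
    by (auto simp: Z1_comp_def m2.cocycle1_iff_derivation)
  show ?case
    by unfold_locales
       (simp_all add: cochain_scale_def x.add y.add x.scale y.scale m2V.scale_right_distrib
         mult.commute)
qed

lemma B1_subset_Z1: "B1 \<subseteq> Z1"
  unfolding B1_def Z1_def by (rule cochain.span_mono) (use B1_comp_subset_Z1_comp in blast)

lemma cochain_bracket_antisym: "cochain_bracket b a = - cochain_bracket a b"
  by (auto simp: cochain_bracket_def fun_eq_iff)

lemma cochain_bracket_add_left:
  "Vector_Spaces.linear m2_scale m2_scale b \<Longrightarrow>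
    cochain_bracket (a + a') b = cochain_bracket a b + cochain_bracket a' b"
  by (auto simp: cochain_bracket_def fun_eq_iff Vector_Spaces.linear_iff)

lemma cochain_bracket_scale_left:
  "Vector_Spaces.linear m2_scale m2_scale b \<Longrightarrow>
    cochain_bracket (cochain_scale c a) b = cochain_scale c (cochain_bracket a b)"
  by (auto simp: cochain_bracket_def cochain_scale_def fun_eq_iff Vector_Spaces.linear_iff
      m2V.scale_right_diff_distrib)

lemma cochain_bracket_add_right:
  "Vector_Spaces.linear m2_scale m2_scale a \<Longrightarrow>
    cochain_bracket a (b + b') = cochain_bracket a b + cochain_bracket a b'"
  by (auto simp: cochain_bracket_def fun_eq_iff Vector_Spaces.linear_iff)

lemma cochain_bracket_scale_right:
  "Vector_Spaces.linear m2_scale m2_scale a \<Longrightarrow>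
    cochain_bracket a (cochain_scale c b) = cochain_scale c (cochain_bracket a b)"
  by (auto simp: cochain_bracket_def cochain_scale_def fun_eq_iff Vector_Spaces.linear_iff
      m2V.scale_right_diff_distrib)

lemma cochain_bracket_span:
  assumes step: "\<And>l m a b. a \<in> Z1_comp l \<Longrightarrow> b \<in> S m \<Longrightarrow> cochain_bracket a b \<in> S (l + m)"
    and a: "a \<in> Z1" and S: "\<And>m. S m \<subseteq> Z1_comp m" and b: "b \<in> cochain.span (\<Union>m. S m)"
  shows "cochain_bracket a b \<in> cochain.span (\<Union>m. S m)"
proof -
  have SZ: "b \<in> Z1_comp m" if "b \<in> S m" for b m using S that by blast
  have ZC: "Vector_Spaces.linear m2_scale m2_scale a'" if "a' \<in> Z1_comp l" for a' l
    using that by (auto simp: Z1_comp_def m2.cocycle1_iff_derivation)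
  have *: "cochain_bracket a b' \<in> cochain.span (\<Union>m. S m)" if b': "b' \<in> S m" for b' m
    using a unfolding Z1_def
  proof (induction rule: cochain.span_induct_alt)
    case base
    have "cochain_bracket 0 b' = cochain_scale 0 (cochain_bracket 0 b')"
      using cochain_bracket_scale_left[OF ZC[OF SZ[OF b']], of 0 0]
      by (simp only: cochain.scale_zero_left)
    then show ?case by (simp only: cochain.scale_zero_left cochain.span_zero)
  next
    case (step c x y)
    then obtain l where "x \<in> Z1_comp l" by auto
    then have "cochain_bracket x b' \<in> cochain.span (\<Union>m. S m)"
      using assms(1) b' by (blast intro: cochain.span_base)
    with step show ?case
      unfolding cochain_bracket_add_left[OF ZC[OF SZ[OF b']]]
        cochain_bracket_scale_left[OF ZC[OF SZ[OF b']]]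
      by (blast intro: cochain.span_add cochain.span_scale)
  qed
  note la = Z1_linear[OF a]
  from b show ?thesis
  proof (induction rule: cochain.span_induct_alt)
    case base
    have "cochain_bracket a 0 = cochain_scale 0 (cochain_bracket a 0)"
      using cochain_bracket_scale_right[OF la, of 0 0]
      by (simp only: cochain.scale_zero_left)
    then show ?case by (simp only: cochain.scale_zero_left cochain.span_zero)
  next
    case (step c x y)
    then have "cochain_bracket a x \<in> cochain.span (\<Union>m. S m)" using * by blast
    with step show ?case
      unfolding cochain_bracket_add_right[OF la] cochain_bracket_scale_right[OF la]
      by (blast intro: cochain.span_add cochain.span_scale)
  qed
qed

lemma cochain_bracket_Z1: "a \<in> Z1 \<Longrightarrow> b \<in> Z1 \<Longrightarrow> cochain_bracket a b \<in> Z1"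
  using cochain_bracket_span[where S = Z1_comp, OF cochain_bracket_Z1_comp _ subset_refl]
  by (simp add: Z1_def)

lemma cochain_bracket_B1: "a \<in> Z1 \<Longrightarrow> b \<in> B1 \<Longrightarrow> cochain_bracket a b \<in> B1"
  unfolding B1_def
  by (rule cochain_bracket_span[where S = B1_comp, OF cochain_bracket_B1_comp _ B1_comp_subset_Z1_comp])

lemmas Z1_closed = cochain.subspace_span[of "\<Union>l. Z1_comp l", folded Z1_def]
lemmas B1_closed = cochain.subspace_span[of "\<Union>l. B1_comp l", folded B1_def]
lemmas Z1_rules = Z1_closed[THEN cochain.subspace_0] Z1_closed[THEN cochain.subspace_add]
  Z1_closed[THEN cochain.subspace_diff] Z1_closed[THEN cochain.subspace_neg]
  Z1_closed[THEN cochain.subspace_scale]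
lemmas B1_rules = B1_closed[THEN cochain.subspace_0] B1_closed[THEN cochain.subspace_add]
  B1_closed[THEN cochain.subspace_diff] B1_closed[THEN cochain.subspace_neg]
  B1_closed[THEN cochain.subspace_scale]

definition H1_rel :: "('k::field_char_0 m2 \<Rightarrow> 'k m2) \<Rightarrow> ('k m2 \<Rightarrow> 'k m2) \<Rightarrow> bool" where
  "H1_rel a b \<longleftrightarrow> a \<in> Z1 \<and> b \<in> Z1 \<and> a - b \<in> B1"

lemma H1_rel_refl_iff: "H1_rel a a \<longleftrightarrow> a \<in> Z1"
  by (simp add: H1_rel_def B1_rules)

lemma H1_rel_eqI: "a = b \<Longrightarrow> a \<in> Z1 \<Longrightarrow> H1_rel a b"
  by (simp add: H1_rel_refl_iff)

lemma part_equivp_H1_rel: "part_equivp (H1_rel :: ('k::field_char_0 m2 \<Rightarrow> 'k m2) \<Rightarrow> _)"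
proof (rule part_equivpI)
  show "\<exists>a :: 'k m2 \<Rightarrow> 'k m2. H1_rel a a"
    by (rule exI[of _ 0]) (simp add: H1_rel_def Z1_rules B1_rules)
  show "symp (H1_rel :: ('k m2 \<Rightarrow> 'k m2) \<Rightarrow> _)"
    by (rule sympI) (use B1_rules(4) in \<open>fastforce simp: H1_rel_def\<close>)
  show "transp (H1_rel :: ('k m2 \<Rightarrow> 'k m2) \<Rightarrow> _)"
  proof (rule transpI)
    fix a b c :: "'k m2 \<Rightarrow> 'k m2" assume *: "H1_rel a b" "H1_rel b c"
    then have "(a - b) + (b - c) \<in> B1" unfolding H1_rel_def by (intro B1_rules(2)) blast+
    with * show "H1_rel a c" by (simp add: H1_rel_def)
  qed
qed

quotient_type (overloaded) 'k H1 = "'k::field_char_0 m2 \<Rightarrow> 'k m2" / partial: H1_rel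
  by (rule part_equivp_H1_rel)

instantiation H1 :: (field_char_0) ab_group_add
begin

lift_definition zero_H1 :: "'a H1" is 0
  by (simp add: H1_rel_def Z1_rules B1_rules)

lift_definition plus_H1 :: "'a H1 \<Rightarrow> 'a H1 \<Rightarrow> 'a H1" is "\<lambda>a b. a + b"
  unfolding H1_rel_def by (simp only: Z1_rules add_diff_add B1_rules simp_thms)

lift_definition minus_H1 :: "'a H1 \<Rightarrow> 'a H1 \<Rightarrow> 'a H1" is "\<lambda>a b. a - b"
proof -
  fix a a' b b' :: "'a m2 \<Rightarrow> 'a m2"
  assume *: "H1_rel a a'" "H1_rel b b'"
  have "a - b - (a' - b') = (a - a') - (b - b')" by simp
  then show "H1_rel (a - b) (a' - b')" using * unfolding H1_rel_def by (simp only: Z1_rules B1_rules simp_thms)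
qed

lift_definition uminus_H1 :: "'a H1 \<Rightarrow> 'a H1" is "\<lambda>a. - a"
proof -
  fix a a' :: "'a m2 \<Rightarrow> 'a m2"
  assume *: "H1_rel a a'"
  have "- a - - a' = - (a - a')" by simp
  then show "H1_rel (- a) (- a')" using * unfolding H1_rel_def by (simp only: Z1_rules B1_rules simp_thms)
qed

instance
proof
  fix a b c :: "'a H1"
  show "a + b + c = a + (b + c)"
    by transfer (rule H1_rel_eqI, auto simp: H1_rel_refl_iff add.assoc intro!: Z1_rules)
  show "a + b = b + a"
    by transfer (rule H1_rel_eqI, auto simp: H1_rel_refl_iff add.commute intro!: Z1_rules)
  show "0 + a = a"
    by transfer (rule H1_rel_eqI, auto simp: H1_rel_refl_iff intro!: Z1_rules)
  show "- a + a = 0"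
    by transfer (rule H1_rel_eqI, auto simp: H1_rel_refl_iff intro!: Z1_rules)
  show "a - b = a + - b"
    by transfer (rule H1_rel_eqI, auto simp: H1_rel_refl_iff intro!: Z1_rules)
qed

end

lift_definition H1_scale :: "'k::field_char_0 \<Rightarrow> 'k H1 \<Rightarrow> 'k H1" is cochain_scale
  unfolding H1_rel_def
  by (simp only: Z1_rules B1_rules simp_thms flip: cochain.scale_right_diff_distrib)

lift_definition H1_bracket :: "'k::field_char_0 H1 \<Rightarrow> 'k H1 \<Rightarrow> 'k H1" is cochain_bracket
proof -
  fix a a' b b' :: "'k m2 \<Rightarrow> 'k m2"
  assume "H1_rel a a'" "H1_rel b b'"
  then have *: "a \<in> Z1" "a' \<in> Z1" "a - a' \<in> B1" "b \<in> Z1" "b' \<in> Z1" "b - b' \<in> B1"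
    by (auto simp: H1_rel_def)
  have "cochain_bracket a b - cochain_bracket a' b'
      = cochain_bracket a (b - b') - cochain_bracket b' (a - a')"
    using Z1_linear[OF *(1)] Z1_linear[OF *(5)]
    by (auto simp: cochain_bracket_def fun_eq_iff module_hom.diff
        dest!: Vector_Spaces.linear.axioms(3))
  also have "\<dots> \<in> B1"
    by (rule B1_rules(3)[OF cochain_bracket_B1 cochain_bracket_B1]) (use * in blast)+
  finally show "H1_rel (cochain_bracket a b) (cochain_bracket a' b')"
    using * by (simp add: H1_rel_def cochain_bracket_Z1)
qed

text \<open>The class of a cochain in \<open>Z1\<close>; unspecified on all other cochains.\<close>

definition H1_class :: "('k::field_char_0 m2 \<Rightarrow> 'k m2) \<Rightarrow> 'k H1" where
  "H1_class a = abs_H1 a"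

definition H1_comp :: "int \<Rightarrow> 'k::field_char_0 H1 set" where
  "H1_comp l = H1_class ` Z1_comp l"

lemma Z1_comp_subset_Z1: "Z1_comp l \<subseteq> Z1"
  unfolding Z1_def by (auto intro: cochain.span_base)

lemma H1_class_eq_iff: "a \<in> Z1 \<Longrightarrow> b \<in> Z1 \<Longrightarrow> H1_class a = H1_class b \<longleftrightarrow> a - b \<in> B1"
proof -
  assume "a \<in> Z1" "b \<in> Z1"
  moreover from this have "H1_rel a a" "H1_rel b b" by (auto simp: H1_rel_def B1_rules)
  ultimately show ?thesis
    using Quotient_rel[OF Quotient_H1, of a b] by (auto simp: H1_class_def H1_rel_def)
qed

lemma B1_subset_coboundaries1: "B1 \<subseteq> m2.coboundaries1"
proof
  fix a :: "'a m2 \<Rightarrow> 'a m2" assume "a \<in> B1"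
  then show "a \<in> m2.coboundaries1"
    unfolding B1_def
  proof (induction rule: cochain.span_induct_alt)
    case base
    have "0 = m2.d0 0" by (simp add: m2.d0_def fun_eq_iff m2.br_zero_right)
    then show ?case unfolding m2.coboundaries1_def by (rule range_eqI)
  next
    case (step c x y)
    then obtain u v where uv: "x = m2.d0 u" "y = m2.d0 v"
      by (auto simp: B1_comp_def m2.coboundaries1_def)
    have "cochain_scale c x + y = m2.d0 (m2_scale c u + v)"
      by (simp add: uv m2.d0_def fun_eq_iff cochain_scale_def m2.br_add_right m2.br_scale_right)
    then show ?case by (auto simp: m2.coboundaries1_def)
  qed
qed

text \<open>Hence \<open>H1_comp l\<close> is the quotient of \<open>Z1_comp l\<close> by \<open>B1_comp l\<close>, and \<open>H1\<close> is the direct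
  sum of these quotients.\<close>

lemma H1_class_eq_iff_comp:
  assumes a: "a \<in> Z1_comp l" and b: "b \<in> Z1_comp l"
  shows "H1_class a = H1_class b \<longleftrightarrow> a - b \<in> B1_comp l"
proof -
  have "a - b \<in> m2.homogeneous_cochains1 m2_e l"
  proof -
    have l: "Vector_Spaces.linear m2_scale m2_scale a" "Vector_Spaces.linear m2_scale m2_scale b"
      and h: "\<exists>c. a (m2_e i) = m2_scale c (m2_e (i + l))"
        "\<exists>c. b (m2_e i) = m2_scale c (m2_e (i + l))" for i
      using a b by (auto simp: Z1_comp_def m2.homogeneous_cochains1_def m2.cochains1_def)
    have "a - b \<in> Z1" using a b Z1_comp_subset_Z1 by (blast intro: Z1_rules)
    then have "Vector_Spaces.linear m2_scale m2_scale (a - b)" by (rule Z1_linear)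
    moreover have "\<exists>c. (a - b) (m2_e i) = m2_scale c (m2_e (i + l))" for i
      using h[of i] by (auto simp flip: m2V.scale_left_diff_distrib)
    ultimately show ?thesis by (simp add: m2.homogeneous_cochains1_def m2.cochains1_def)
  qed
  moreover have "B1_comp l \<subseteq> B1" unfolding B1_def by (auto intro: cochain.span_base)
  ultimately have "a - b \<in> B1 \<longleftrightarrow> a - b \<in> B1_comp l"
    using B1_subset_coboundaries1 by (auto simp: B1_comp_def)
  then show ?thesis using H1_class_eq_iff a b Z1_comp_subset_Z1 by blast
qed

lemma H1_bracket_class:
  assumes "a \<in> Z1" "b \<in> Z1"
  shows "H1_bracket (H1_class a) (H1_class b) = H1_class (cochain_bracket a b)"
  unfolding H1_class_def
  by (rule H1_bracket.abs_eq) (use assms in \<open>simp_all only: H1_rel_refl_iff\<close>)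

end

theory Submission
  imports Defs
begin

text \<open>
  A cocycle with adjoint coefficients is a derivation, and \<open>m\<^sub>2\<close> is generated by \<open>e\<^sub>1\<close> and \<open>e\<^sub>2\<close>:
  a derivation \<open>a\<close> of weight \<open>l\<close> is determined by the two coefficients in
  \<open>a(e\<^sub>1) = d\<^sub>1 e\<^bsub>l+1\<^esub>\<close> and \<open>a(e\<^sub>2) = d\<^sub>2 e\<^bsub>l+2\<^esub>\<close>.  Computing \<open>a(e\<^sub>5)\<close> in the two ways provided by
  \<open>e\<^sub>5 = [e\<^sub>2, e\<^sub>3] = [e\<^sub>1, [e\<^sub>1, [e\<^sub>1, e\<^sub>2]]]\<close> gives \<open>d\<^sub>2 = 2 d\<^sub>1\<close> in weight 0, \<open>d\<^sub>1 = 0\<close> in weight 1 and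
  \<open>d\<^sub>2 = 0\<close> in weight \<open>-1\<close>.  The inner derivations \<open>[\<cdot>, e\<^sub>l]\<close> have \<open>(d\<^sub>1, d\<^sub>2)\<close> equal to \<open>(0, -1)\<close>, \<open>(1, 0)\<close>
  and \<open>(1, 1)\<close> for \<open>l = 1\<close>, \<open>l = 2\<close> and \<open>l \<ge> 3\<close>, and in weights below
  \<open>-1\<close> both values are zero because \<open>e\<^sub>k = 0\<close> for \<open>k \<le> 0\<close>.  So modulo coboundaries at most one parameter
  is left in the weights 0, 2, 3, 4, ..., where \<open>\<omega>\<close>, \<open>\<alpha>\<close> and the \<open>\<gamma>\<^sub>l\<close> realise it, and none in the others.

  The formal carrier of this computation is one linear functional for each weight \<open>l\<close>, the coordinate
  \<open>cochain_coord l\<close>: on cocycles of weight \<open>l\<close> it is up to a factor \<open>d\<^sub>1\<close>, \<open>d\<^sub>2\<close> and \<open>d\<^sub>2 - d\<^sub>1\<close> in the weights 0, 2 and \<open>l \<ge> 3\<close>.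
  It vanishes on coboundaries and on cocycles of every other weight, and a cocycle of weight \<open>l\<close> on
  which it vanishes is a coboundary (\<open>cocycle_coord_eq_0_imp_coboundary\<close>).  A class is therefore known
  once its coordinates are known, which gives three things: the decomposition into
  weights is unique; \<open>\<omega>\<close>, \<open>\<alpha>\<close> and the \<open>\<gamma>\<^sub>l\<close>, having non-zero coordinates, span the
  cohomology; and a bracket of two of \<open>\<alpha>\<close>, \<open>\<gamma>\<^sub>3\<close>, \<open>\<gamma>\<^sub>4\<close>, ... is zero in cohomology, because its
  weight is at least 4 and it kills \<open>e\<^sub>3\<close>: both factors act on all \<open>e\<^sub>k\<close>, \<open>k \<ge> 3\<close>, as multiples of shifts.
\<close>

section \<open>Spans in graded spaces and Lie algebras\<close>

context vector_space
begin

lemma span_Union_subspaces_decomposition: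
  assumes G: "\<And>l. subspace (G l)" and x: "x \<in> span (\<Union>l. G l)"
  shows "\<exists>f. (\<forall>l. f l \<in> G l) \<and> finite {l. f l \<noteq> 0} \<and> x = (\<Sum>l | f l \<noteq> 0. f l)"
  using x
proof (induction rule: span_induct_alt)
  case base
  show ?case by (rule exI[of _ "\<lambda>_. 0"]) (simp add: G subspace_0)
next
  case (step c x y)
  then obtain m f where x: "x \<in> G m" and f: "\<forall>l. f l \<in> G l" "finite {l. f l \<noteq> 0}"
      "y = (\<Sum>l | f l \<noteq> 0. f l)" by blast
  define g where "g = f(m := scale c x + f m)"
  let ?A = "insert m {l. f l \<noteq> 0}"
  have sub: "{l. g l \<noteq> 0} \<subseteq> ?A" by (auto simp: g_def)
  have "(\<Sum>l | g l \<noteq> 0. g l) = (\<Sum>l\<in>?A. g l)"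
    by (rule sum.mono_neutral_left) (use f sub in auto)
  also have "\<dots> = (\<Sum>l\<in>?A. (if l = m then scale c x else 0) + f l)"
    by (rule sum.cong) (auto simp: g_def)
  also have "\<dots> = scale c x + (\<Sum>l\<in>?A. f l)"
    using f(2) by (simp add: sum.distrib)
  also have "(\<Sum>l\<in>?A. f l) = y"
    unfolding f(3) by (rule sum.mono_neutral_right) (use f in auto)
  finally have "scale c x + y = (\<Sum>l | g l \<noteq> 0. g l)" by simp
  moreover have "g l \<in> G l" for l
    using x f(1) G by (auto simp: g_def intro: subspace_add subspace_scale)
  moreover have "finite {l. g l \<noteq> 0}"
    using finite_subset[OF sub] f(2) by simp
  ultimately show ?case by blast
qed

end

context lie_algebra
begin

lemma span_subset_lie_generated: "span S \<subseteq> lie_generated S"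
  unfolding lie_generated_def hull_def lie_subalgebra_def using span_minimal by blast

lemma bracket_eq_0_on_span:
  assumes "\<And>x y. x \<in> S \<Longrightarrow> y \<in> S \<Longrightarrow> bracket x y = 0" and "x \<in> span S" "y \<in> span S"
  shows "bracket x y = 0"
proof -
  have *: "bracket x y = 0" if "x \<in> S" for x
    using \<open>y \<in> span S\<close>
    by (induction rule: span_induct_alt)
       (simp_all add: br_zero_right br_add_right br_scale_right assms(1) that)
  show ?thesis
    using \<open>x \<in> span S\<close>
  proof (induction rule: span_induct_alt)
    case base
    show ?case using br_antisym[of 0 y] by (simp add: br_zero_right)
  qed (simp add: br_add_left br_scale_left *)
qed

text \<open>When the generators commute, their span is already closed under the bracket, so it contains
  the subalgebra they generate.\<close>

lemma lie_generated_abelian: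
  assumes "\<And>x y. x \<in> S \<Longrightarrow> y \<in> S \<Longrightarrow> bracket x y = 0"
    and "x \<in> lie_generated S" "y \<in> lie_generated S"
  shows "bracket x y = 0"
proof -
  have "lie_subalgebra (span S)"
    unfolding lie_subalgebra_def
    using bracket_eq_0_on_span[OF assms(1)] by (auto simp: span_zero)
  then have "lie_generated S \<subseteq> span S"
    unfolding lie_generated_def by (intro hull_minimal span_superset)
  then show ?thesis using assms bracket_eq_0_on_span by blast
qed

end

section \<open>Cocycles determined by basis elements\<close>

lemma lookup_m2_e_iff: "lookup (m2_e k) i = (if int i + 1 = k then 1 else 0)"
  by (cases "k \<ge> 1") (auto simp: lookup_m2_e m2_e_def lookup_single when_def)

lemma m2_e_nonpos [simp]: "k \<le> 0 \<Longrightarrow> m2_e k = 0"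
  by (simp add: m2_e_def)

lemma m2_e_eq_0_iff [simp]: "m2_e k = (0 :: 'k::field_char_0 m2) \<longleftrightarrow> k \<le> 0"
proof
  assume "m2_e k = (0 :: 'k m2)"
  then have "lookup (m2_e k :: 'k m2) (nat (k - 1)) = 0" by simp
  then show "k \<le> 0" by (simp add: lookup_m2_e_iff split: if_splits)
qed (simp add: m2_e_def)

text \<open>\<open>e\<^sub>1\<close> and \<open>e\<^sub>2\<close> generate \<open>m\<^sub>2\<close>, since \<open>e\<^bsub>k+1\<^esub> = [e\<^sub>1, e\<^sub>k]\<close>.\<close>

lemma cocycle_eq_0:
  assumes a: "a \<in> m2.cocycles1" and "a (m2_e 1) = 0" "a (m2_e 2) = 0"
  shows "a = 0"
proof -
  have lin: "Vector_Spaces.linear m2_scale m2_scale a"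
    and der: "a (m2_bracket x y) = m2_bracket (a x) y + m2_bracket x (a y)" for x y
    using a by (auto simp: m2.cocycle1_iff_derivation)
  have "a (m2_e k) = 0" if "k \<ge> 2" for k
    using that
  proof (induction rule: int_ge_induct)
    case (step k)
    then show ?case
      using der[of "m2_e 1" "m2_e k"] assms(2)
      by (simp add: m2_bracket_basis m2_basis_bracket_def m2_bracket_simps)
  qed (fact assms)
  then have "a (m2_e k) = 0" if "k \<ge> 1" for k
    using that assms(2) by (cases "k = 1") auto
  then show ?thesis using m2_linear_eq_0[OF lin] by auto
qed

lemma subspace_cocycles1: "cochain.subspace m2.cocycles1"
proof (rule cochain.subspaceI)
  note iff = m2.cocycle1_iff_derivation Vector_Spaces.linear_iff
  show "0 \<in> m2.cocycles1"
    by (simp add: iff vector_space_m2 m2_bracket_simps)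
  show "a + b \<in> m2.cocycles1" if "a \<in> m2.cocycles1" "b \<in> m2.cocycles1" for a b
    using that by (simp add: iff m2_bracket_simps m2V.scale_right_distrib add_ac)
  show "cochain_scale c a \<in> m2.cocycles1" if "a \<in> m2.cocycles1" for c a
    using that
    by (simp add: iff cochain_scale_def m2_bracket_simps m2V.scale_right_distrib mult.commute)
qed

lemma cocycle_inner_if_inner_on_generators:
  assumes a: "a \<in> m2.cocycles1"
    and "a (m2_e 1) = m2_bracket (m2_e 1) v" "a (m2_e 2) = m2_bracket (m2_e 2) v"
  shows "a \<in> m2.coboundaries1"
proof -
  have d0: "m2.d0 v \<in> m2.coboundaries1" by (simp add: m2.coboundaries1_def)
  have "a - m2.d0 v \<in> m2.cocycles1"
    using a d0 m2.coboundaries1_subset_cocycles1 by (blast intro: cochain.subspace_diff[OF subspace_cocycles1])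
  then have "a - m2.d0 v = 0"
    by (rule cocycle_eq_0) (simp_all add: assms m2.d0_def)
  then show ?thesis using d0 by simp
qed

text \<open>The failure of the derivation rule is bilinear and alternating, so pairs \<open>i < j\<close> suffice.\<close>

lemma cocycles1_if_derivation_on_basis:
  assumes a: "a \<in> m2.cochains1"
    and der: "\<And>i j. 1 \<le> i \<Longrightarrow> i < j \<Longrightarrow>
      a (m2_bracket (m2_e i) (m2_e j)) = m2_bracket (a (m2_e i)) (m2_e j) + m2_bracket (m2_e i) (a (m2_e j))"
  shows "a \<in> m2.cocycles1"
proof -
  interpret a: Vector_Spaces.linear m2_scale m2_scale a using a by (simp add: m2.cochains1_def)
  define D where "D x y = m2_bracket (a x) y + m2_bracket x (a y) - a (m2_bracket x y)" for x y
  have l1: "Vector_Spaces.linear m2_scale m2_scale (\<lambda>x. D x y)" for y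
    by unfold_locales
      (simp_all add: D_def m2_bracket_simps a.add a.scale algebra_simps)
  have l2: "Vector_Spaces.linear m2_scale m2_scale (\<lambda>y. D x y)" for x
    by unfold_locales
      (simp_all add: D_def m2_bracket_simps a.add a.scale algebra_simps)
  have anti: "D y x = - D x y" for x y
    using m2_bracket_antisym[of x "a y"] m2_bracket_antisym[of "a x" y] m2_bracket_antisym[of x y]
    by (simp add: D_def a.neg)
  have "D (m2_e i) (m2_e j) = 0" if "1 \<le> i" "1 \<le> j" for i j
  proof (cases i j rule: linorder_cases)
    case less
    then show ?thesis using der that by (simp add: D_def)
  next
    case equal
    then show ?thesis
      using m2_bracket_antisym[of "m2_e i" "a (m2_e i)"] by (simp add: D_def m2_bracket_self a.zero)
  next
    case greater
    then show ?thesis using der that anti[of "m2_e j" "m2_e i"] by (simp add: D_def)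
  qed
  then have "D (m2_e i) y = 0" if "1 \<le> i" for i y
    using that m2_linear_eq_0[OF l2] by blast
  then have "D x y = 0" for x y
    using m2_linear_eq_0[OF l1] by blast
  then show ?thesis
    using a by (simp add: D_def m2.cocycle1_iff_derivation m2.cochains1_def)
qed

lemma homogeneous_cochain_if_on_basis:
  assumes "a \<in> m2.cochains1"
    and "\<And>k. k \<ge> 1 \<Longrightarrow> \<exists>c. a (m2_e k) = m2_scale c (m2_e (k + l))"
  shows "a \<in> m2.homogeneous_cochains1 m2_e l"
proof -
  have "\<exists>c. a (m2_e k) = m2_scale c (m2_e (k + l))" for k
  proof (cases "k \<ge> 1")
    case False
    interpret a: Vector_Spaces.linear m2_scale m2_scale a
      using assms(1) by (simp add: m2.cochains1_def)
    have "a (m2_e k) = m2_scale 0 (m2_e (k + l))" using False by (simp add: a.zero)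
    then show ?thesis ..
  qed (use assms in auto)
  then show ?thesis using assms(1) by (simp add: m2.homogeneous_cochains1_def)
qed

section \<open>One coordinate for each weight\<close>

text \<open>With \<open>e\<^sub>k\<close> stored at position \<open>k - 1\<close>, this is the coefficient of \<open>e\<^sub>4\<close> in \<open>a(e\<^sub>2)\<close> for \<open>l = 2\<close>, and the
  coefficient of \<open>e\<^bsub>l+3\<^esub>\<close> in \<open>a(e\<^sub>3)\<close> for \<open>l = 0\<close> and \<open>l \<ge> 3\<close>.  The exception at \<open>l = 2\<close> is forced:
  \<open>[e\<^sub>3, e\<^sub>2] = - e\<^sub>5\<close>, so the coefficient of \<open>e\<^sub>5\<close> in \<open>a(e\<^sub>3)\<close> does not vanish on coboundaries.  For the
  remaining \<open>l\<close> there is no non-trivial class to detect.\<close>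

definition cochain_coord :: "int \<Rightarrow> ('k::field_char_0 m2 \<Rightarrow> 'k m2) \<Rightarrow> 'k" where
  "cochain_coord l a =
    (if l = 2 then lookup (a (m2_e 2)) 3
     else if l = 0 \<or> l \<ge> 3 then lookup (a (m2_e 3)) (nat (l + 2)) else 0)"

lemma cochain_coord_add: "cochain_coord l (a + b) = cochain_coord l a + cochain_coord l b"
  by (simp add: cochain_coord_def lookup_add)

lemma cochain_coord_diff: "cochain_coord l (a - b) = cochain_coord l a - cochain_coord l b"
  by (simp add: cochain_coord_def lookup_minus)

lemma cochain_coord_scale: "cochain_coord l (cochain_scale c a) = c * cochain_coord l a"
  by (simp add: cochain_coord_def cochain_scale_def)

lemma lookup_m2_bracket_eq_0:
  assumes "\<And>i. i \<ge> 1 \<Longrightarrow> lookup (m2_bracket x (m2_e i)) n = 0"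
  shows "lookup (m2_bracket x v) n = 0"
proof -
  interpret Vector_Spaces.linear m2_scale m2_scale "m2_bracket x"
    by (rule m2_bracket_linear_right)
  have "m2_bracket x v = m2_bracket x (\<Sum>i\<in>keys v. m2_scale (lookup v i) (m2_e (int i + 1)))"
    using m2_expand[of "keys v" v] by simp
  then show ?thesis by (simp add: sum scale lookup_sum assms)
qed

text \<open>\<open>e\<^sub>4\<close> does not occur in \<open>[e\<^sub>2, v]\<close>, and only \<open>e\<^sub>4\<close> and \<open>e\<^sub>5\<close> can occur in \<open>[e\<^sub>3, v]\<close>.\<close>

lemma cochain_coord_coboundary:
  assumes "a \<in> m2.coboundaries1" shows "cochain_coord l a = 0"
proof -
  obtain v where a: "a = (\<lambda>x. m2_bracket x v)"
    using assms by (auto simp: m2.coboundaries1_def m2.d0_def)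
  have "lookup (m2_bracket (m2_e 2) v) 3 = 0"
    by (rule lookup_m2_bracket_eq_0)
       (auto simp: m2_bracket_basis m2_basis_bracket_def lookup_m2_e_iff)
  moreover have "lookup (m2_bracket (m2_e 3) v) (nat (l + 2)) = 0" if "l = 0 \<or> l \<ge> 3"
    by (rule lookup_m2_bracket_eq_0)
       (use that in \<open>auto simp: m2_bracket_basis m2_basis_bracket_def lookup_m2_e_iff\<close>)
  ultimately show ?thesis by (simp add: cochain_coord_def a)
qed

lemma cochain_coord_other_weight:
  assumes "a \<in> Z1_comp m" "l \<noteq> m" shows "cochain_coord l a = 0"
proof -
  have "\<exists>c. a (m2_e i) = m2_scale c (m2_e (i + m))" for i
    using assms(1) by (simp add: Z1_comp_def m2.homogeneous_cochains1_def)
  from this[of 2] this[of 3] obtain c d where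
    "a (m2_e 2) = m2_scale c (m2_e (2 + m))" "a (m2_e 3) = m2_scale d (m2_e (3 + m))" by blast
  then show ?thesis using assms(2) by (auto simp: cochain_coord_def lookup_m2_e_iff)
qed

text \<open>This is the computation of the cohomology.  Two derivations that agree on \<open>e\<^sub>1\<close> and \<open>e\<^sub>2\<close> are equal, so
  in each weight it is enough to exhibit a \<open>v\<close> with \<open>a(e\<^sub>i) = [e\<^sub>i, v]\<close> for \<open>i = 1, 2\<close>.  In the proof,
  \<open>d i\<close> is the coefficient of \<open>a(e\<^sub>i)\<close>.\<close>

lemma cocycle_coord_eq_0_imp_coboundary:
  fixes a :: "'k::field_char_0 m2 \<Rightarrow> 'k m2"
  assumes a: "a \<in> Z1_comp l" and coord: "cochain_coord l a = 0"
  shows "a \<in> B1_comp l"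
proof -
  have Z: "a \<in> m2.cocycles1" and H: "a \<in> m2.homogeneous_cochains1 m2_e l"
    using a by (auto simp: Z1_comp_def)
  have der: "a (m2_bracket x y) = m2_bracket (a x) y + m2_bracket x (a y)" for x y
    using Z by (auto simp: m2.cocycle1_iff_derivation)
  obtain d where d: "\<And>i. a (m2_e i) = m2_scale (d i) (m2_e (i + l))"
    using H unfolding m2.homogeneous_cochains1_def by (simp, metis)
  note r12 = der[of "m2_e 1" "m2_e 2"] and r13 = der[of "m2_e 1" "m2_e 3"]
    and r14 = der[of "m2_e 1" "m2_e 4"] and r23 = der[of "m2_e 2" "m2_e 3"]
  note br = d m2_bracket_basis m2_basis_bracket_def m2_bracket_simps 
  consider "l \<le> -2" | "l = -1" | "l = 0" | "l = 1" | "l = 2" | "l \<ge> 3" by linarith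
  then have "\<exists>v. a (m2_e 1) = m2_bracket (m2_e 1) v \<and> a (m2_e 2) = m2_bracket (m2_e 2) v"
  proof cases
    case 1
    \<comment> \<open>Both \<open>e\<^bsub>l+1\<^esub>\<close> and \<open>e\<^bsub>l+2\<^esub>\<close> are zero.\<close>
    then show ?thesis by (intro exI[of _ 0]) (simp add: br)
  next
    case 2
    \<comment> \<open>\<open>a(e\<^sub>1) = 0\<close> as \<open>e\<^sub>0 = 0\<close>; the two expressions of \<open>e\<^sub>5\<close> then force \<open>d 2 = 0\<close>.\<close>
    then show ?thesis using r12 r13 r14 r23 by (intro exI[of _ 0]) (simp add: br)
  next
    case 3
    \<comment> \<open>The first equation comes from the two expressions of \<open>e\<^sub>5\<close>, the second is \<open>d 3 = 0\<close>.\<close>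
    have d2: "d 2 = 2 * d 1" and "d 1 + d 2 = 0"
      using r12 r13 r14 r23 coord 3
      by (simp_all add: br cochain_coord_def lookup_m2_e_iff flip: m2V.scale_left_distrib)
    then have "3 * d 1 = 0" by (simp add: algebra_simps)
    then show ?thesis using 3 d2 by (intro exI[of _ 0]) (simp add: br)
  next
    case 4
    \<comment> \<open>The two expressions of \<open>e\<^sub>5\<close> force \<open>d 1 = 0\<close>; what remains is a multiple of \<open>[\<cdot>, e\<^sub>1]\<close>.\<close>
    then show ?thesis using r12 r13 r14 r23
      by (intro exI[of _ "m2_scale (- d 2) (m2_e 1)"]) (simp add: br flip: m2V.scale_left_distrib)
  next
    case 5
    then show ?thesis using coord
      by (intro exI[of _ "m2_scale (d 1) (m2_e 2)"]) (simp add: br cochain_coord_def lookup_m2_e_iff)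
  next
    case 6
    have "d 3 = d 2 - d 1"
      using r12 6 by (simp add: br flip: m2V.scale_left_diff_distrib)
    moreover have "d 3 = 0" using coord 6 by (simp add: d cochain_coord_def lookup_m2_e_iff)
    ultimately show ?thesis using 6
      by (intro exI[of _ "m2_scale (d 1) (m2_e l)"]) (simp add: br add.commute)
  qed
  then have "a \<in> m2.coboundaries1" using cocycle_inner_if_inner_on_generators[OF Z] by blast
  then show ?thesis using H by (simp add: B1_comp_def)
qed


section \<open>The Lie algebra structure on cohomology\<close>

lemma H1_rel_cochain_coord: "H1_rel a b \<Longrightarrow> cochain_coord l a = cochain_coord l b"
  using cochain_coord_coboundary[of "a - b" l] B1_subset_coboundaries1
  by (auto simp: H1_rel_def cochain_coord_diff)

lift_definition H1_coord :: "int \<Rightarrow> 'k::field_char_0 H1 \<Rightarrow> 'k" is cochain_coord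
  by (rule H1_rel_cochain_coord)

lemma H1_coord_class: "a \<in> Z1 \<Longrightarrow> H1_coord l (H1_class a) = cochain_coord l a"
  unfolding H1_class_def by (rule H1_coord.abs_eq) (simp only: H1_rel_refl_iff)

lemma H1_class_add: "a \<in> Z1 \<Longrightarrow> b \<in> Z1 \<Longrightarrow> H1_class (a + b) = H1_class a + H1_class b"
  unfolding H1_class_def by (rule plus_H1.abs_eq[symmetric]) (simp_all only: H1_rel_refl_iff)

lemma H1_class_scale: "a \<in> Z1 \<Longrightarrow> H1_class (cochain_scale c a) = H1_scale c (H1_class a)"
  unfolding H1_class_def by (rule H1_scale.abs_eq[symmetric]) (simp only: H1_rel_refl_iff)

lemma H1_class_zero: "H1_class 0 = 0"
  unfolding H1_class_def by (simp add: zero_H1.abs_eq)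

lemma H1_class_surj: obtains a where "a \<in> Z1" "x = H1_class a"
  by (rule that[of "rep_H1 x"])
     (simp_all add: H1_class_def Quotient_abs_rep[OF Quotient_H1] Quotient_rep_reflp[OF Quotient_H1]
       flip: H1_rel_refl_iff)

lemma cochain_bracket_jacobi:
  assumes "a \<in> Z1" "b \<in> Z1" "c \<in> Z1"
  shows "cochain_bracket a (cochain_bracket b c) + cochain_bracket b (cochain_bracket c a)
    + cochain_bracket c (cochain_bracket a b) = 0"
proof -
  interpret a: Vector_Spaces.linear m2_scale m2_scale a using assms by (blast intro: Z1_linear)
  interpret b: Vector_Spaces.linear m2_scale m2_scale b using assms by (blast intro: Z1_linear)
  interpret c: Vector_Spaces.linear m2_scale m2_scale c using assms by (blast intro: Z1_linear)
  show ?thesis by (simp add: cochain_bracket_def fun_eq_iff a.diff b.diff c.diff)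
qed

lemma vector_space_H1: "vector_space (H1_scale :: 'k::field_char_0 \<Rightarrow> 'k H1 \<Rightarrow> 'k H1)"
proof
  fix r s :: 'k and x y :: "'k H1"
  obtain a b where ab: "a \<in> Z1" "b \<in> Z1" "x = H1_class a" "y = H1_class b"
    by (metis H1_class_surj)
  show "H1_scale r (x + y) = H1_scale r x + H1_scale r y"
    by (simp add: ab Z1_rules cochain.scale_right_distrib flip: H1_class_add H1_class_scale)
  show "H1_scale (r + s) x = H1_scale r x + H1_scale s x"
    by (simp add: ab Z1_rules cochain.scale_left_distrib flip: H1_class_add H1_class_scale)
  show "H1_scale r (H1_scale s x) = H1_scale (r * s) x"
    by (simp add: ab Z1_rules flip: H1_class_scale)
  show "H1_scale 1 x = x"
    by (simp add: ab Z1_rules flip: H1_class_scale)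
qed

global_interpretation H1V: vector_space H1_scale
  by (rule vector_space_H1)

lemma H1_bracket_self: "H1_bracket x x = 0"
proof -
  obtain a where "a \<in> Z1" "x = H1_class a" by (rule H1_class_surj)
  moreover have "cochain_bracket a a = 0" by (simp add: cochain_bracket_def fun_eq_iff)
  ultimately show ?thesis by (simp add: H1_bracket_class H1_class_zero)
qed

lemma H1_jacobi:
  "H1_bracket x (H1_bracket y z) + H1_bracket y (H1_bracket z x) + H1_bracket z (H1_bracket x y) = 0"
proof -
  obtain a b c where "a \<in> Z1" "b \<in> Z1" "c \<in> Z1" "x = H1_class a" "y = H1_class b" "z = H1_class c"
    by (metis H1_class_surj)
  then show ?thesis
    by (simp add: H1_bracket_class cochain_bracket_Z1 Z1_rules cochain_bracket_jacobi H1_class_zero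
        flip: H1_class_add)
qed

lemma H1_bracket_linear_left: "Vector_Spaces.linear H1_scale H1_scale (\<lambda>x. H1_bracket x y)"
proof -
  obtain c where c: "c \<in> Z1" "y = H1_class c" by (rule H1_class_surj)
  have "H1_bracket (x + x') y = H1_bracket x y + H1_bracket x' y"
    and "H1_bracket (H1_scale r x) y = H1_scale r (H1_bracket x y)" for r x x'
  proof -
    obtain a b where "a \<in> Z1" "b \<in> Z1" "x = H1_class a" "x' = H1_class b"
      by (metis H1_class_surj)
    with c show "H1_bracket (x + x') y = H1_bracket x y + H1_bracket x' y"
      and "H1_bracket (H1_scale r x) y = H1_scale r (H1_bracket x y)"
      by (simp_all add: H1_bracket_class cochain_bracket_Z1 Z1_rules Z1_linear
          cochain_bracket_add_left cochain_bracket_scale_left flip: H1_class_add H1_class_scale)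
  qed
  then show ?thesis by unfold_locales
qed

lemma H1_bracket_linear_right: "Vector_Spaces.linear H1_scale H1_scale (\<lambda>y. H1_bracket x y)"
proof -
  obtain c where c: "c \<in> Z1" "x = H1_class c" by (rule H1_class_surj)
  have "H1_bracket x (y + y') = H1_bracket x y + H1_bracket x y'"
    and "H1_bracket x (H1_scale r y) = H1_scale r (H1_bracket x y)" for r y y'
  proof -
    obtain a b where "a \<in> Z1" "b \<in> Z1" "y = H1_class a" "y' = H1_class b"
      by (metis H1_class_surj)
    with c show "H1_bracket x (y + y') = H1_bracket x y + H1_bracket x y'"
      and "H1_bracket x (H1_scale r y) = H1_scale r (H1_bracket x y)"
      by (simp_all add: H1_bracket_class cochain_bracket_Z1 Z1_rules Z1_linear
          cochain_bracket_add_right cochain_bracket_scale_right flip: H1_class_add H1_class_scale)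
  qed
  then show ?thesis by unfold_locales
qed

global_interpretation H1: lie_algebra H1_scale H1_bracket
proof (intro lie_algebra.intro vector_space_H1 lie_algebra_axioms.intro)
qed (fact H1_bracket_linear_left H1_bracket_linear_right H1_bracket_self H1_jacobi)+

section \<open>The grading\<close>

lemma H1_coord_add: "H1_coord l (x + y) = H1_coord l x + H1_coord l y"
  by transfer (rule cochain_coord_add)

lemma H1_coord_scale: "H1_coord l (H1_scale c x) = c * H1_coord l x"
  by transfer (rule cochain_coord_scale)

lemma H1_coord_zero: "H1_coord l 0 = 0"
  using H1_coord_scale[of l 0 0] by simp

lemma H1_coord_diff: "H1_coord l (x - y) = H1_coord l x - H1_coord l y"
  by transfer (rule cochain_coord_diff)

lemma H1_coord_sum: "H1_coord l (sum f A) = (\<Sum>i\<in>A. H1_coord l (f i))"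
  by (induction A rule: infinite_finite_induct) (simp_all add: H1_coord_zero H1_coord_add)

lemma subspace_homogeneous_cochains1: "cochain.subspace (m2.homogeneous_cochains1 m2_e l)"
proof (rule cochain.subspaceI)
  note iff = m2.homogeneous_cochains1_def m2.cochains1_def Vector_Spaces.linear_iff
  show "0 \<in> m2.homogeneous_cochains1 m2_e l"
    by (auto simp: iff vector_space_m2 intro: exI[of _ 0])
  show "a + b \<in> m2.homogeneous_cochains1 m2_e l"
    if "a \<in> m2.homogeneous_cochains1 m2_e l" "b \<in> m2.homogeneous_cochains1 m2_e l" for a b
    using that unfolding iff
    by (simp add: m2V.scale_right_distrib add_ac) (metis m2V.scale_left_distrib)
  show "cochain_scale c a \<in> m2.homogeneous_cochains1 m2_e l"
    if "a \<in> m2.homogeneous_cochains1 m2_e l" for c a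
    using that unfolding iff
    by (simp add: cochain_scale_def m2V.scale_right_distrib mult.commute) (metis m2V.scale_scale)
qed

lemma Z1_comp_subspace: "cochain.subspace (Z1_comp l)"
  unfolding Z1_comp_def
  by (intro cochain.subspace_inter subspace_cocycles1 subspace_homogeneous_cochains1)

lemma H1_comp_subspace: "H1V.subspace (H1_comp l :: 'a::field_char_0 H1 set)"
proof (rule H1V.subspaceI)
  note Z = Z1_comp_subset_Z1[THEN subsetD]
  show "0 \<in> H1_comp l"
    using cochain.subspace_0[OF Z1_comp_subspace] H1_class_zero
    unfolding H1_comp_def by (metis imageI)
  show "x + y \<in> H1_comp l" if xy: "x \<in> H1_comp l" "y \<in> H1_comp l" for x y :: "'a H1"
  proof -
    from xy obtain a b where ab: "a \<in> Z1_comp l" "b \<in> Z1_comp l" "x = H1_class a" "y = H1_class b"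
      by (auto simp: H1_comp_def)
    then have "x + y = H1_class (a + b)" by (simp add: H1_class_add Z)
    then show ?thesis
      using cochain.subspace_add[OF Z1_comp_subspace] ab unfolding H1_comp_def by blast
  qed
  show "H1_scale c x \<in> H1_comp l" if x: "x \<in> H1_comp l" for c :: 'a and x
  proof -
    from x obtain a where a: "a \<in> Z1_comp l" "x = H1_class a" by (auto simp: H1_comp_def)
    then have "H1_scale c x = H1_class (cochain_scale c a)" by (simp add: H1_class_scale Z)
    then show ?thesis
      using cochain.subspace_scale[OF Z1_comp_subspace] a unfolding H1_comp_def by blast
  qed
qed

text \<open>\<open>Z1\<close> was formed as the span of the homogeneous cocycles; the class map carries this over.\<close>

lemma span_H1_comp: "H1V.span (\<Union>l. H1_comp l) = UNIV"
proof -
  have "H1_class a \<in> H1V.span (\<Union>l. H1_comp l) \<and> a \<in> Z1" if "a \<in> Z1" for a :: "'a m2 \<Rightarrow> 'a m2"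
    using that unfolding Z1_def
  proof (induction rule: cochain.span_induct_alt)
    case base
    show ?case by (simp only: H1_class_zero H1V.span_zero cochain.span_zero simp_thms)
  next
    case (step c x y)
    then have "H1_class x \<in> H1V.span (\<Union>l. H1_comp l)" and x: "x \<in> Z1" and y: "y \<in> Z1"
      using Z1_comp_subset_Z1 by (auto simp: H1_comp_def Z1_def intro!: H1V.span_base)
    with step.IH show ?case
      unfolding Z1_def[symmetric]
      by (simp only: H1_class_add H1_class_scale Z1_rules H1V.span_add H1V.span_scale simp_thms)
  qed
  then show ?thesis by (metis H1_class_surj UNIV_eq_I)
qed

lemma H1_coord_other_weight: "x \<in> H1_comp m \<Longrightarrow> l \<noteq> m \<Longrightarrow> H1_coord l x = 0"
  using Z1_comp_subset_Z1 by (fastforce simp: H1_comp_def H1_coord_class cochain_coord_other_weight)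

lemma H1_comp_eq_0:
  assumes "x \<in> H1_comp l" "H1_coord l x = 0" shows "x = 0"
proof -
  obtain a where a: "a \<in> Z1_comp l" "x = H1_class a" using assms(1) by (auto simp: H1_comp_def)
  then have Z: "a \<in> Z1" using Z1_comp_subset_Z1 by blast
  then have "a \<in> B1_comp l"
    using cocycle_coord_eq_0_imp_coboundary assms(2) a by (simp add: H1_coord_class)
  then have "a - 0 \<in> B1" unfolding B1_def by (auto intro: cochain.span_base)
  then show ?thesis using H1_class_eq_iff[OF Z Z1_rules(1)] by (simp add: a H1_class_zero)
qed

lemma H1_comp_eqI:
  assumes "x \<in> H1_comp l" "y \<in> H1_comp l" "H1_coord l x = H1_coord l y" shows "x = y"
  using H1_comp_eq_0[of "x - y" l] assms H1V.subspace_diff[OF H1_comp_subspace, of x l y]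
  by (simp add: H1_coord_diff)

lemma H1_coord_decomposition:
  assumes "\<And>l. f l \<in> H1_comp l" "finite {l. f l \<noteq> 0}" "x = (\<Sum>l | f l \<noteq> 0. f l)"
  shows "H1_coord m x = H1_coord m (f m)"
proof -
  have "H1_coord m x = (\<Sum>l | f l \<noteq> 0. if l = m then H1_coord m (f m) else 0)"
    unfolding assms(3) H1_coord_sum
    by (rule sum.cong) (use H1_coord_other_weight[OF assms(1)] in auto)
  then show ?thesis using assms(2) by (auto simp: H1_coord_zero)
qed

text \<open>Uniqueness of the decomposition: the coordinate \<open>H1_coord l x\<close> sees only the component of weight \<open>l\<close>
  and determines it.\<close>

lemma graded_lie_algebra_H1: "graded_lie_algebra H1_scale H1_bracket H1_comp"
proof
  show "H1V.subspace (H1_comp l)" for l by (rule H1_comp_subspace)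
  show "\<exists>!f. (\<forall>l. f l \<in> H1_comp l) \<and> finite {l. f l \<noteq> 0} \<and> x = (\<Sum>l | f l \<noteq> 0. f l)" for x :: "'a H1"
  proof (rule ex_ex1I)
    show "\<exists>f. (\<forall>l. f l \<in> H1_comp l) \<and> finite {l. f l \<noteq> 0} \<and> x = (\<Sum>l | f l \<noteq> 0. f l)"
      by (rule H1V.span_Union_subspaces_decomposition) (simp_all add: H1_comp_subspace span_H1_comp)
    show "f = g" if "(\<forall>l. f l \<in> H1_comp l) \<and> finite {l. f l \<noteq> 0} \<and> x = (\<Sum>l | f l \<noteq> 0. f l)"
      "(\<forall>l. g l \<in> H1_comp l) \<and> finite {l. g l \<noteq> 0} \<and> x = (\<Sum>l | g l \<noteq> 0. g l)" for f g
    proof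
      fix l
      show "f l = g l"
      proof (rule H1_comp_eqI)
        show "H1_coord l (f l) = H1_coord l (g l)"
          using H1_coord_decomposition[of f x l] H1_coord_decomposition[of g x l] that by simp
      qed (use that in auto)
    qed
  qed
  show "H1_bracket x y \<in> H1_comp (l + m)" if xy: "x \<in> H1_comp l" "y \<in> H1_comp m" for x y :: "'a H1" and l m
  proof -
    obtain a b where ab: "a \<in> Z1_comp l" "b \<in> Z1_comp m" "x = H1_class a" "y = H1_class b"
      using xy by (auto simp: H1_comp_def)
    then have "H1_bracket x y = H1_class (cochain_bracket a b)"
      using Z1_comp_subset_Z1 by (blast intro: H1_bracket_class)
    then show ?thesis using cochain_bracket_Z1_comp[OF ab(1,2)] by (simp add: H1_comp_def)
  qed
qed

section \<open>Generators and brackets\<close>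

text \<open>Every homogeneous component has dimension at most one.\<close>

lemma H1_comp_eq_scale:
  assumes "g \<in> H1_comp l" "H1_coord l g \<noteq> 0" "x \<in> H1_comp l"
  shows "x = H1_scale (H1_coord l x / H1_coord l g) g"
  by (rule H1_comp_eqI[OF assms(3) H1V.subspace_scale[OF H1_comp_subspace assms(1)]])
     (use assms(2) in \<open>simp add: H1_coord_scale\<close>)

lemma H1_class_in_comp: "a \<in> Z1_comp l \<Longrightarrow> H1_class a \<in> H1_comp l"
  by (simp add: H1_comp_def)

text \<open>The identity already holds for cochains: if \<open>a(e\<^sub>k) = r e\<^bsub>k+l\<^esub>\<close>, then \<open>\<omega>\<close> multiplies \<open>e\<^bsub>k+l\<^esub>\<close> by \<open>k + l\<close>
  and \<open>e\<^sub>k\<close> by \<open>k\<close>.\<close>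

lemma H1_bracket_grading_operator:
  assumes \<omega>: "\<omega> \<in> Z1" "\<And>k. k \<ge> 1 \<Longrightarrow> \<omega> (m2_e k) = m2_scale (of_int k) (m2_e k)"
    and a: "a \<in> Z1_comp l"
  shows "H1_bracket (H1_class \<omega>) (H1_class a) = H1_scale (of_int l) (H1_class a)"
proof -
  have Z: "a \<in> Z1" using a Z1_comp_subset_Z1 by blast
  interpret \<omega>: Vector_Spaces.linear m2_scale m2_scale \<omega> using \<omega>(1) by (rule Z1_linear)
  have eig: "\<omega> (m2_e k) = m2_scale (of_int k) (m2_e k)" for k
    using \<omega>(2)[of k] by (cases "k \<ge> 1") (simp_all add: \<omega>.zero)
  let ?d = "cochain_bracket \<omega> a - cochain_scale (of_int l) a"
  have "?d \<in> Z1" using \<omega>(1) Z by (intro Z1_rules cochain_bracket_Z1)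
  moreover have "?d (m2_e k) = 0" for k
  proof -
    obtain r where r: "a (m2_e k) = m2_scale r (m2_e (k + l))"
      using a by (auto simp: Z1_comp_def m2.homogeneous_cochains1_def)
    have "a (m2_scale (of_int k) (m2_e k)) = m2_scale (of_int k) (a (m2_e k))"
      using Z1_linear[OF Z] by (simp add: Vector_Spaces.linear_iff)
    then show ?thesis
      by (simp add: cochain_bracket_def cochain_scale_def eig r \<omega>.scale algebra_simps
          flip: m2V.scale_left_diff_distrib)
  qed
  ultimately have "?d = 0" using m2_linear_eq_0[OF Z1_linear] by fastforce
  then have "cochain_bracket \<omega> a = cochain_scale (of_int l) a" by simp
  then show ?thesis using \<omega>(1) Z by (simp add: H1_bracket_class H1_class_scale)
qed

text \<open>Multiples of shifts commute, so the commutator kills \<open>e\<^sub>3\<close>.  As its weight is at least 4, its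
  coordinate is read off from the value at \<open>e\<^sub>3\<close>, and the commutator is a coboundary, although it need
  not vanish on \<open>e\<^sub>1\<close> and \<open>e\<^sub>2\<close>.\<close>

lemma H1_bracket_eventual_shifts:
  assumes a: "a \<in> Z1_comp l" "\<And>k. k \<ge> 3 \<Longrightarrow> a (m2_e k) = m2_scale r (m2_e (k + l))"
    and b: "b \<in> Z1_comp m" "\<And>k. k \<ge> 3 \<Longrightarrow> b (m2_e k) = m2_scale s (m2_e (k + m))"
    and "l \<ge> 2" "m \<ge> 2"
  shows "H1_bracket (H1_class a) (H1_class b) = 0"
proof -
  have Z: "a \<in> Z1" "b \<in> Z1" using a b Z1_comp_subset_Z1 by blast+
  then interpret a: Vector_Spaces.linear m2_scale m2_scale a + b: Vector_Spaces.linear m2_scale m2_scale b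
    by (simp_all add: Z1_linear)
  have "cochain_bracket a b (m2_e 3) = 0"
    using \<open>l \<ge> 2\<close> \<open>m \<ge> 2\<close>
    by (simp add: cochain_bracket_def a(2) b(2) a.scale b.scale ac_simps)
  then have "cochain_coord (l + m) (cochain_bracket a b) = 0"
    using \<open>l \<ge> 2\<close> \<open>m \<ge> 2\<close> by (simp add: cochain_coord_def)
  then have "H1_class (cochain_bracket a b) = 0"
    using H1_comp_eq_0[OF H1_class_in_comp[OF cochain_bracket_Z1_comp[OF a(1) b(1)]]] Z
    by (simp add: H1_coord_class cochain_bracket_Z1)
  then show ?thesis using Z by (simp add: H1_bracket_class)
qed

theorem theorem3:
  fixes \<omega> \<alpha> :: "'k::real_normed_field m2 \<Rightarrow> 'k m2"
    and \<gamma> :: "int \<Rightarrow> 'k m2 \<Rightarrow> 'k m2"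
    and b :: 'k and c :: "int \<Rightarrow> 'k"
  assumes b: "b \<noteq> 0"
    and c: "\<And>l. l \<ge> 3 \<Longrightarrow> c l \<noteq> 0"
    and \<omega>_lin: "\<omega> \<in> m2.cochains1"
    and \<omega>: "\<And>k. k \<ge> 1 \<Longrightarrow> \<omega> (m2_e k) = m2_scale (of_int k) (m2_e k)"
    and \<alpha>_lin: "\<alpha> \<in> m2.cochains1"
    and \<alpha>_1: "\<alpha> (m2_e 1) = 0"
    and \<alpha>: "\<And>k. k \<ge> 2 \<Longrightarrow> \<alpha> (m2_e k) = m2_scale b (m2_e (k + 2))"
    and \<gamma>_lin: "\<And>l. l \<ge> 3 \<Longrightarrow> \<gamma> l \<in> m2.cochains1"
    and \<gamma>_1: "\<And>l. l \<ge> 3 \<Longrightarrow> \<gamma> l (m2_e 1) = m2_scale (- (c l / 2)) (m2_e (l + 1))"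
    and \<gamma>_2: "\<And>l. l \<ge> 3 \<Longrightarrow> \<gamma> l (m2_e 2) = m2_scale (c l / 2) (m2_e (l + 2))"
    and \<gamma>: "\<And>l k. l \<ge> 3 \<Longrightarrow> k \<ge> 3 \<Longrightarrow> \<gamma> l (m2_e k) = m2_scale (c l) (m2_e (k + l))"
  shows "graded_lie_algebra H1_scale H1_bracket (H1_comp :: int \<Rightarrow> 'k H1 set)
    \<and> \<omega> \<in> Z1_comp 0 \<and> \<alpha> \<in> Z1_comp 2 \<and> (\<forall>l\<ge>3. \<gamma> l \<in> Z1_comp l)
    \<and> lie_algebra.lie_generated H1_scale H1_bracket
        ({H1_class \<omega>, H1_class \<alpha>} \<union> (\<lambda>l. H1_class (\<gamma> l)) ` {3..}) = UNIV
    \<and> (\<forall>x \<in> lie_algebra.lie_generated H1_scale H1_bracket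
              ({H1_class \<alpha>} \<union> (\<lambda>l. H1_class (\<gamma> l)) ` {3..}).
         \<forall>y \<in> lie_algebra.lie_generated H1_scale H1_bracket
              ({H1_class \<alpha>} \<union> (\<lambda>l. H1_class (\<gamma> l)) ` {3..}).
         H1_bracket x y = 0)
    \<and> H1_bracket (H1_class \<omega>) (H1_class \<alpha>) = H1_scale 2 (H1_class \<alpha>)
    \<and> (\<forall>l\<ge>3. H1_bracket (H1_class \<omega>) (H1_class (\<gamma> l)) = H1_scale (of_int l) (H1_class (\<gamma> l)))"
proof -
  have cochain_0: "a 0 = 0" if "a \<in> m2.cochains1" for a :: "'k m2 \<Rightarrow> 'k m2"
    using that module_hom.zero[OF Vector_Spaces.linear.axioms(3)] by (auto simp: m2.cochains1_def)
  have \<omega>_Z: "\<omega> \<in> Z1_comp 0"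
  proof -
    have "\<omega> \<in> m2.cocycles1"
      by (rule cocycles1_if_derivation_on_basis[OF \<omega>_lin])
         (auto simp: m2_bracket_basis m2_basis_bracket_def m2_bracket_simps \<omega> cochain_0[OF \<omega>_lin]
           simp flip: m2V.scale_left_distrib)
    then show ?thesis
      using homogeneous_cochain_if_on_basis[OF \<omega>_lin, of 0] \<omega> by (auto simp: Z1_comp_def)
  qed
  have \<alpha>_Z: "\<alpha> \<in> Z1_comp 2"
  proof -
    have "\<alpha> \<in> m2.cocycles1"
      by (rule cocycles1_if_derivation_on_basis[OF \<alpha>_lin])
         (auto simp: m2_bracket_basis m2_basis_bracket_def m2_bracket_simps \<alpha> \<alpha>_1 cochain_0[OF \<alpha>_lin])
    moreover have "\<exists>r. \<alpha> (m2_e k) = m2_scale r (m2_e (k + 2))" if "k \<ge> 1" for k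
      using that \<alpha>_1 \<alpha>[of k] by (cases "k = 1") (auto intro: exI[of _ 0])
    ultimately show ?thesis
      using homogeneous_cochain_if_on_basis[OF \<alpha>_lin, of 2] by (auto simp: Z1_comp_def)
  qed
  have \<gamma>_Z: "\<gamma> l \<in> Z1_comp l" if l: "l \<ge> 3" for l
  proof -
    \<comment> \<open>Needed for \<open>\<gamma>\<^sub>l(e\<^sub>3) = [\<gamma>\<^sub>l(e\<^sub>1), e\<^sub>2] + [e\<^sub>1, \<gamma>\<^sub>l(e\<^sub>2)]\<close>, where simplification merges the two
      equal summands into a product with the numeral 2.\<close>
    have half: "2 * m2_scale (c l / 2) v = m2_scale (c l) v" for v
      by (simp add: mult_2 flip: m2V.scale_left_distrib)
    have "\<gamma> l \<in> m2.cocycles1"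
      by (rule cocycles1_if_derivation_on_basis[OF \<gamma>_lin[OF l]])
         (use l in \<open>auto simp: m2_bracket_basis m2_basis_bracket_def m2_bracket_simps \<gamma> \<gamma>_1 \<gamma>_2
           cochain_0[OF \<gamma>_lin[OF l]] half ac_simps\<close>)
    moreover have "\<exists>r. \<gamma> l (m2_e k) = m2_scale r (m2_e (k + l))" if k: "k \<ge> 1" for k
    proof -
      consider "k = 1" | "k = 2" | "k \<ge> 3" using k by linarith
      then show ?thesis
        using \<gamma>_1[OF l] \<gamma>_2[OF l] \<gamma>[OF l, of k] by cases (metis add.commute)+
    qed
    ultimately show ?thesis
      using homogeneous_cochain_if_on_basis[OF \<gamma>_lin[OF l], of l] by (auto simp: Z1_comp_def)
  qed
  note Z = Z1_comp_subset_Z1[THEN subsetD]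

  let ?T = "{H1_class \<alpha>} \<union> (\<lambda>l. H1_class (\<gamma> l)) ` {3..}"
  let ?S = "{H1_class \<omega>, H1_class \<alpha>} \<union> (\<lambda>l. H1_class (\<gamma> l)) ` {3..}"

  have "x \<in> H1V.span ?S" if x: "x \<in> H1_comp l" for x l
  proof -
    have *: ?thesis if "a \<in> Z1_comp l" "cochain_coord l a \<noteq> 0" "H1_class a \<in> ?S" for a
    proof -
      have "H1_coord l (H1_class a) \<noteq> 0" using that(2) by (simp add: H1_coord_class[OF Z[OF that(1)]])
      from H1_comp_eq_scale[OF H1_class_in_comp[OF that(1)] this x]
      show ?thesis using that(3) by (metis H1V.span_base H1V.span_scale)
    qed
    consider "l < 0 \<or> l = 1" | "l = 0" | "l = 2" | "l \<ge> 3" by linarith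
    then show ?thesis
    proof cases
      case 1
      obtain a where a: "a \<in> Z1_comp l" "x = H1_class a" using x by (auto simp: H1_comp_def)
      then have "H1_coord l x = 0" using 1 by (auto simp: H1_coord_class[OF Z[OF a(1)]] cochain_coord_def)
      then have "x = 0" using H1_comp_eq_0 x by blast
      then show ?thesis by (simp only: H1V.span_zero)
    next
      case 2
      then show ?thesis
        using *[of \<omega>] \<omega>_Z by (simp add: cochain_coord_def \<omega> lookup_m2_e_iff)
    next
      case 3
      then show ?thesis
        using *[of \<alpha>] \<alpha>_Z b by (simp add: cochain_coord_def \<alpha> lookup_m2_e_iff)
    next
      case 4
      then show ?thesis
        using *[of "\<gamma> l"] \<gamma>_Z[of l] c by (simp add: cochain_coord_def \<gamma> lookup_m2_e_iff)
    qed
  qed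
  then have "H1V.span (\<Union>l. H1_comp l) \<subseteq> H1V.span ?S"
    by (intro H1V.span_minimal H1V.subspace_span) blast
  then have gen: "H1.lie_generated ?S = UNIV"
    using span_H1_comp H1.span_subset_lie_generated[of ?S] by blast

  have "\<exists>l r a. x = H1_class a \<and> l \<ge> 2 \<and> a \<in> Z1_comp l
      \<and> (\<forall>k\<ge>3. a (m2_e k) = m2_scale r (m2_e (k + l)))" if x: "x \<in> ?T" for x
  proof (cases "x = H1_class \<alpha>")
    case True
    then show ?thesis using \<alpha>_Z \<alpha> by (intro exI[of _ 2] exI[of _ b] exI[of _ \<alpha>]) simp
  next
    case False
    then obtain l where "l \<ge> 3" "x = H1_class (\<gamma> l)" using x by auto
    then show ?thesis using \<gamma>_Z \<gamma> by (intro exI[of _ l] exI[of _ "c l"] exI[of _ "\<gamma> l"]) simp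
  qed
  then have "H1_bracket x y = 0" if "x \<in> ?T" "y \<in> ?T" for x y
    using H1_bracket_eventual_shifts that by metis
  then have abelian: "H1_bracket x y = 0"
    if "x \<in> H1.lie_generated ?T" "y \<in> H1.lie_generated ?T" for x y
    using H1.lie_generated_abelian that by blast

  have "H1_bracket (H1_class \<omega>) (H1_class a) = H1_scale (of_int l) (H1_class a)"
    if "a \<in> Z1_comp l" for a l
    using H1_bracket_grading_operator[OF Z[OF \<omega>_Z] \<omega> that] .
  from this[OF \<alpha>_Z] this[OF \<gamma>_Z] show ?thesis
    using graded_lie_algebra_H1 \<omega>_Z \<alpha>_Z \<gamma>_Z gen abelian by simp
qed

end
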